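(* Let $m,n,d\ge 1$ and $n_1,n_2\ge 0$ be integers with $n_1+n_2=n$, $m>n$ and $m\ge n+d$. Let $A=[A_a,A_b]\in\mathbb{Q}_{\mathbb{R}}^{m\times n}$ with $A_a=A_{a0}+A_{a1}\mathbf{i}+A_{a2}\mathbf{j}+A_{a3}\mathbf{k}\in\mathbb{Q}_{\mathbb{R}}^{m\times n_1}$ of full column rank and $A_b=A_{b0}+A_{b1}\mathbf{i}+A_{b2}\mathbf{j}+A_{b3}\mathbf{k}\in\mathbb{Q}_{\mathbb{R}}^{m\times n_2}$, and let $B=B_0+B_1\mathbf{i}+B_2\mathbf{j}+B_3\mathbf{k}\in\mathbb{Q}_{\mathbb{R}}^{m\times d}$ (all components real matrices). Put $$C_a=[A_{a0}^T,A_{a1}^T,A_{a2}^T,A_{a3}^T]^T\in\mathbb{R}^{4m\times n_1},\quad C_b=[A_{b0}^T,A_{b1}^T,A_{b2}^T,A_{b3}^T]^T\in\mathbb{R}^{4m\times n_2},\quad D=[B_0^T,B_1^T,B_2^T,B_3^T]^T\in\mathbb{R}^{4m\times d}.$$ Let $X=[X_a^T,X_b^T]^T\in\mathbb{R}^{n\times d}$ be a real matrix with $X_a\in\mathbb{R}^{n_1\times d}$, $X_b\in\mathbb{R}^{n_2\times d}$. Then $X$ is an RBMTLS solution (for $A_a,A_b,B$) if and only if $X$ is a real MTLS solution (for $C_a,C_b,D$). Moreover, let $X$ be a real MTLS solution, and let $\widetilde E_b=[E_{b0}^T,E_{b1}^T,E_{b2}^T,E_{b3}^T]^T\in\mathbb{R}^{4m\times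 n_2}$ and $\widetilde G=[G_0^T,G_1^T,G_2^T,G_3^T]^T\in\mathbb{R}^{4m\times d}$ (with $E_{bt}\in\mathbb{R}^{m\times n_2}$, $G_t\in\mathbb{R}^{m\times d}$) be such that $C_aX_a+(C_b+\widetilde E_b)X_b=D+\widetilde G$ and $\|[\widetilde E_b,\widetilde G]\|_F$ equals the minimum value of the real MTLS problem (such matrices exist). Set $\widehat E_b=E_{b0}+E_{b1}\mathbf{i}+E_{b2}\mathbf{j}+E_{b3}\mathbf{k}$ and $\widehat G=G_0+G_1\mathbf{i}+G_2\mathbf{j}+G_3\mathbf{k}$. Then $A_aX_a+(A_b+\widehat E_b)X_b=B+\widehat G$ and $\|[\widehat E_b,\widehat G]\|_F$ equals the minimum value of the RBMTLS problem, so that $X$ is an RBMTLS solution with corresponding $\widehat E_b$ and $\widehat G$.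
   Context: Reduced biquaternions: $\mathbb{Q}_{\mathbb{R}}$ is the commutative real algebra of elements $a=a_0+a_1\mathbf{i}+a_2\mathbf{j}+a_3\mathbf{k}$ ($a_t\in\mathbb{R}$) with $\mathbf{i}^2=\mathbf{k}^2=-1$, $\mathbf{j}^2=1$, $\mathbf{i}\mathbf{j}=\mathbf{j}\mathbf{i}=\mathbf{k}$, $\mathbf{j}\mathbf{k}=\mathbf{k}\mathbf{j}=\mathbf{i}$, $\mathbf{k}\mathbf{i}=\mathbf{i}\mathbf{k}=-\mathbf{j}$. The norm is $\|a\|=\sqrt{a_0^2+a_1^2+a_2^2+a_3^2}$, and for $M=(m_{ij})$ over $\mathbb{Q}_{\mathbb{R}}$, $\|M\|_F=\big(\sum_{i,j}\|m_{ij}\|^2\big)^{1/2}$. Real matrices are viewed as matrices over $\mathbb{Q}_{\mathbb{R}}$. A matrix over $\mathbb{Q}_{\mathbb{R}}$ with columns $v_1,\dots,v_p$ has full column rank if the only real scalars with $x_1v_1+\cdots+x_pv_p=0$ are $x_1=\cdots=x_p=0$. RBMTLS problem (unknown $X$ real): minimize $\|[\widehat E_b,\widehat G]\|_F$ over $X_a\in\mathbb{R}^{n_1\times d}$, $X_b\in\mathbb{R}^{n_2\times d}$, $\widehat E_b\in\mathbb{Q}_{\mathbb{R}}^{m\times n_2}$, $\widehat G\in\mathbb{Q}_{\mathbb{R}}^{m\times d}$ subject to $A_aX_a+(A_b+\widehat E_b)X_b=B+\widehat G$. An RBMTLS solution is a real $X=[X_a^T,X_b^T]^T$ for which there are $\widehat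 E_b,\widehat G$ such that $(X_a,X_b,\widehat E_b,\widehat G)$ is feasible and attains the minimum. Real MTLS problem: minimize $\|[\widetilde E_b,\widetilde G]\|_F$ over $X_a\in\mathbb{R}^{n_1\times d}$, $X_b\in\mathbb{R}^{n_2\times d}$, $\widetilde E_b\in\mathbb{R}^{4m\times n_2}$, $\widetilde G\in\mathbb{R}^{4m\times d}$ subject to $C_aX_a+(C_b+\widetilde E_b)X_b=D+\widetilde G$. A real MTLS solution is an $X=[X_a^T,X_b^T]^T$ for which there are $\widetilde E_b,\widetilde G$ such that $(X_a,X_b,\widetilde E_b,\widetilde G)$ is feasible and attains the minimum. If $n_1=0$ or $n_2=0$, the corresponding blocks are empty. *)

theory Defs
  imports "Jordan_Normal_Form.Matrix" "HOL-Analysis.Inner_Product"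
begin

section \<open>Reduced biquaternions\<close>

codatatype rbq = RBQ (rb0: real) (rb1: real) (rb2: real) (rb3: real)

lemma rbq_eq_iff:
  "x = y \<longleftrightarrow> rb0 x = rb0 y \<and> rb1 x = rb1 y \<and> rb2 x = rb2 y \<and> rb3 x = rb3 y"
  by (auto intro: rbq.expand)

text \<open>The product is the bilinear extension of the multiplication table of the
  units \<open>1, i, j, k\<close>; see \<open>rb_units_mult\<close> below.\<close>

instantiation rbq :: comm_ring_1
begin

primcorec zero_rbq where
  "rb0 0 = 0" | "rb1 0 = 0" | "rb2 0 = 0" | "rb3 0 = 0"

primcorec one_rbq where
  "rb0 1 = 1" | "rb1 1 = 0" | "rb2 1 = 0" | "rb3 1 = 0"

primcorec plus_rbq where
  "rb0 (x + y) = rb0 x + rb0 y"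
| "rb1 (x + y) = rb1 x + rb1 y"
| "rb2 (x + y) = rb2 x + rb2 y"
| "rb3 (x + y) = rb3 x + rb3 y"

primcorec uminus_rbq where
  "rb0 (- x) = - rb0 x"
| "rb1 (- x) = - rb1 x"
| "rb2 (- x) = - rb2 x"
| "rb3 (- x) = - rb3 x"

primcorec minus_rbq where
  "rb0 (x - y) = rb0 x - rb0 y"
| "rb1 (x - y) = rb1 x - rb1 y"
| "rb2 (x - y) = rb2 x - rb2 y"
| "rb3 (x - y) = rb3 x - rb3 y"

primcorec times_rbq where
  "rb0 (x * y) = rb0 x * rb0 y - rb1 x * rb1 y + rb2 x * rb2 y - rb3 x * rb3 y"
| "rb1 (x * y) = rb0 x * rb1 y + rb1 x * rb0 y + rb2 x * rb3 y + rb3 x * rb2 y"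
| "rb2 (x * y) = rb0 x * rb2 y + rb2 x * rb0 y - rb1 x * rb3 y - rb3 x * rb1 y"
| "rb3 (x * y) = rb0 x * rb3 y + rb3 x * rb0 y + rb1 x * rb2 y + rb2 x * rb1 y"

instance
  by standard (simp_all add: rbq_eq_iff algebra_simps)

end

instantiation rbq :: real_algebra_1
begin

primcorec scaleR_rbq where
  "rb0 (scaleR r x) = r * rb0 x"
| "rb1 (scaleR r x) = r * rb1 x"
| "rb2 (scaleR r x) = r * rb2 x"
| "rb3 (scaleR r x) = r * rb3 x"

instance
  by standard (simp_all add: rbq_eq_iff algebra_simps)

end

text \<open>The norm is not submultiplicative, so \<^typ>\<open>rbq\<close> is no instance of
  \<^class>\<open>real_normed_algebra\<close>.\<close>

instantiation rbq :: real_inner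
begin

definition norm_rbq :: "rbq \<Rightarrow> real" where
  "norm_rbq a = sqrt ((rb0 a)\<^sup>2 + (rb1 a)\<^sup>2 + (rb2 a)\<^sup>2 + (rb3 a)\<^sup>2)"

definition inner_rbq :: "rbq \<Rightarrow> rbq \<Rightarrow> real" where
  "inner_rbq a b = rb0 a * rb0 b + rb1 a * rb1 b + rb2 a * rb2 b + rb3 a * rb3 b"

definition sgn_rbq :: "rbq \<Rightarrow> rbq" where
  "sgn_rbq a = a /\<^sub>R norm a"

definition dist_rbq :: "rbq \<Rightarrow> rbq \<Rightarrow> real" where
  "dist_rbq a b = norm (a - b)"

definition uniformity_rbq :: "(rbq \<times> rbq) filter" where
  [code del]: "uniformity_rbq = (INF e\<in>{0 <..}. principal {(x, y). dist x y < e})"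

definition open_rbq :: "rbq set \<Rightarrow> bool" where
  [code del]: "open_rbq U \<longleftrightarrow>
     (\<forall>x\<in>U. eventually (\<lambda>(x', y). x' = x \<longrightarrow> y \<in> U) uniformity)"

instance
proof
  fix x y z :: rbq and r :: real
  show "0 \<le> inner x x"
    by (simp add: inner_rbq_def)
  have sq: "inner x x = (rb0 x)\<^sup>2 + (rb1 x)\<^sup>2 + (rb2 x)\<^sup>2 + (rb3 x)\<^sup>2"
    by (simp add: inner_rbq_def power2_eq_square)
  then show "norm x = sqrt (inner x x)"
    by (simp add: norm_rbq_def)
  show "inner x x = 0 \<longleftrightarrow> x = 0"
    unfolding sq by (simp add: rbq_eq_iff add_nonneg_eq_0_iff)
qed (simp_all add: inner_rbq_def sgn_rbq_def dist_rbq_def uniformity_rbq_def open_rbq_def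
      algebra_simps)

end

definition rb_i :: rbq where "rb_i = RBQ 0 1 0 0"
definition rb_j :: rbq where "rb_j = RBQ 0 0 1 0"
definition rb_k :: rbq where "rb_k = RBQ 0 0 0 1"

lemma rb_of_real [simp]:
  "rb0 (of_real r) = r" "rb1 (of_real r) = 0" "rb2 (of_real r) = 0" "rb3 (of_real r) = 0"
  by (simp_all add: of_real_def)

lemma rb_units_mult:
  "rb_i * rb_i = -1" "rb_j * rb_j = 1" "rb_k * rb_k = -1"
  "rb_i * rb_j = rb_k" "rb_j * rb_i = rb_k"
  "rb_j * rb_k = rb_i" "rb_k * rb_j = rb_i"
  "rb_k * rb_i = - rb_j" "rb_i * rb_k = - rb_j"
  by (simp_all add: rbq_eq_iff rb_i_def rb_j_def rb_k_def)

lemma rbq_expand: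
  "a = of_real (rb0 a) + of_real (rb1 a) * rb_i + of_real (rb2 a) * rb_j + of_real (rb3 a) * rb_k"
  by (simp add: rbq_eq_iff rb_i_def rb_j_def rb_k_def)


section \<open>Matrices\<close>

abbreviation rb_of_real_mat :: "real mat \<Rightarrow> rbq mat" where
  "rb_of_real_mat \<equiv> map_mat of_real"

definition rb_mat :: "real mat \<Rightarrow> real mat \<Rightarrow> real mat \<Rightarrow> real mat \<Rightarrow> rbq mat" where
  "rb_mat M0 M1 M2 M3 =
     rb_of_real_mat M0 + rb_i \<cdot>\<^sub>m rb_of_real_mat M1
       + rb_j \<cdot>\<^sub>m rb_of_real_mat M2 + rb_k \<cdot>\<^sub>m rb_of_real_mat M3"

definition append_cols :: "'a::zero mat \<Rightarrow> 'a mat \<Rightarrow> 'a mat" (infixr "@\<^sub>c" 65) where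
  "M @\<^sub>c N = four_block_mat M N (0\<^sub>m 0 (dim_col M)) (0\<^sub>m 0 (dim_col N))"

definition stack4 :: "real mat \<Rightarrow> real mat \<Rightarrow> real mat \<Rightarrow> real mat \<Rightarrow> real mat" where
  "stack4 M0 M1 M2 M3 = M0 @\<^sub>r M1 @\<^sub>r M2 @\<^sub>r M3"

definition frob_norm :: "'a::real_normed_vector mat \<Rightarrow> real" where
  "frob_norm M = sqrt (\<Sum>i<dim_row M. \<Sum>j<dim_col M. (norm (M $$ (i, j)))\<^sup>2)"

text \<open>Only \<^emph>\<open>real\<close> coefficients are used in the linear combinations of the columns.\<close>

definition full_column_rank :: "rbq mat \<Rightarrow> bool" where
  "full_column_rank M \<longleftrightarrow>
     (\<forall>x :: nat \<Rightarrow> real.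
        (\<forall>i<dim_row M. (\<Sum>j<dim_col M. x j *\<^sub>R M $$ (i, j)) = 0) \<longrightarrow> (\<forall>j<dim_col M. x j = 0))"


section \<open>The two mixed total least squares problems\<close>

text \<open>All dimensions are read off the data matrices. The minimum value is meaningful only
  if the minimum is attained, i.e. if a solution exists.\<close>

definition rbmtls_feasible ::
  "rbq mat \<Rightarrow> rbq mat \<Rightarrow> rbq mat \<Rightarrow> real mat \<times> real mat \<times> rbq mat \<times> rbq mat \<Rightarrow> bool" where
  "rbmtls_feasible Aa Ab B = (\<lambda>(Xa, Xb, E, G).
     Xa \<in> carrier_mat (dim_col Aa) (dim_col B) \<and>
     Xb \<in> carrier_mat (dim_col Ab) (dim_col B) \<and>
     E \<in> carrier_mat (dim_row B) (dim_col Ab) \<and>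
     G \<in> carrier_mat (dim_row B) (dim_col B) \<and>
     Aa * rb_of_real_mat Xa + (Ab + E) * rb_of_real_mat Xb = B + G)"

definition mtls_feasible ::
  "real mat \<Rightarrow> real mat \<Rightarrow> real mat \<Rightarrow> real mat \<times> real mat \<times> real mat \<times> real mat \<Rightarrow> bool" where
  "mtls_feasible Ca Cb D = (\<lambda>(Xa, Xb, E, G).
     Xa \<in> carrier_mat (dim_col Ca) (dim_col D) \<and>
     Xb \<in> carrier_mat (dim_col Cb) (dim_col D) \<and>
     E \<in> carrier_mat (dim_row D) (dim_col Cb) \<and>
     G \<in> carrier_mat (dim_row D) (dim_col D) \<and>
     Ca * Xa + (Cb + E) * Xb = D + G)"

definition tls_objective ::
  "real mat \<times> real mat \<times> 'a::real_normed_vector mat \<times> 'a mat \<Rightarrow> real" where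
  "tls_objective = (\<lambda>(Xa, Xb, E, G). frob_norm (E @\<^sub>c G))"

definition rbmtls_minimizer ::
  "rbq mat \<Rightarrow> rbq mat \<Rightarrow> rbq mat \<Rightarrow> real mat \<times> real mat \<times> rbq mat \<times> rbq mat \<Rightarrow> bool" where
  "rbmtls_minimizer Aa Ab B = is_arg_min tls_objective (rbmtls_feasible Aa Ab B)"

definition mtls_minimizer ::
  "real mat \<Rightarrow> real mat \<Rightarrow> real mat \<Rightarrow> real mat \<times> real mat \<times> real mat \<times> real mat \<Rightarrow> bool" where
  "mtls_minimizer Ca Cb D = is_arg_min tls_objective (mtls_feasible Ca Cb D)"

definition rbmtls_min_value :: "rbq mat \<Rightarrow> rbq mat \<Rightarrow> rbq mat \<Rightarrow> real" where
  "rbmtls_min_value Aa Ab B = (LEAST r. \<exists>q. rbmtls_feasible Aa Ab B q \<and> r = tls_objective q)"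

definition mtls_min_value :: "real mat \<Rightarrow> real mat \<Rightarrow> real mat \<Rightarrow> real" where
  "mtls_min_value Ca Cb D = (LEAST r. \<exists>q. mtls_feasible Ca Cb D q \<and> r = tls_objective q)"

definition rbmtls_solution :: "rbq mat \<Rightarrow> rbq mat \<Rightarrow> rbq mat \<Rightarrow> real mat \<Rightarrow> bool" where
  "rbmtls_solution Aa Ab B X \<longleftrightarrow>
     (\<exists>Xa Xb E G. X = Xa @\<^sub>r Xb \<and> rbmtls_minimizer Aa Ab B (Xa, Xb, E, G))"

definition mtls_solution :: "real mat \<Rightarrow> real mat \<Rightarrow> real mat \<Rightarrow> real mat \<Rightarrow> bool" where
  "mtls_solution Ca Cb D X \<longleftrightarrow>
     (\<exists>Xa Xb E G. X = Xa @\<^sub>r Xb \<and> mtls_minimizer Ca Cb D (Xa, Xb, E, G))"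

end

theory Submission
  imports Defs
begin

text \<open>Stacking the four real components of a matrix over the reduced biquaternions is an
  additive bijection onto the real matrices with four times as many rows. It preserves the
  Frobenius norm, and it is compatible with multiplication by a \<^emph>\<open>real\<close> matrix on the right.
  Since the unknowns are real, it maps the feasible points of one problem bijectively onto those
  of the other and keeps the objective, so minimizers and minimum values correspond.\<close>

section \<open>Row and column concatenation of matrices\<close>

lemma index_append_rows:
  assumes "dim_col M = dim_col N" "i < dim_row M + dim_row N" "j < dim_col N"
  shows "(M @\<^sub>r N) $$ (i, j) = (if i < dim_row M then M $$ (i, j) else N $$ (i - dim_row M, j))"
  using assms by (simp add: append_rows_def)

lemma dim_append_rows [simp]:
  "dim_row (M @\<^sub>r N) = dim_row M + dim_row N" "dim_col (M @\<^sub>r N) = dim_col M"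
  by (simp_all add: append_rows_def)

lemma dim_append_cols [simp]:
  "dim_row (M @\<^sub>c N) = dim_row M" "dim_col (M @\<^sub>c N) = dim_col M + dim_col N"
  by (simp_all add: append_cols_def)

lemma add_append_rows:
  fixes M N M' N' :: "'a::monoid_add mat"
  assumes "dim_row M = dim_row M'" "dim_row N = dim_row N'"
    and "dim_col M = dim_col N" "dim_col M' = dim_col M" "dim_col N' = dim_col M"
  shows "(M + M') @\<^sub>r (N + N') = (M @\<^sub>r N) + (M' @\<^sub>r N')"
  by (rule eq_matI) (use assms in \<open>auto simp: index_append_rows\<close>)

lemma mult_append_rows:
  fixes M N X :: "'a::semiring_0 mat"
  assumes "dim_col M = k" "dim_col N = k" "dim_row X = k"
  shows "(M * X) @\<^sub>r (N * X) = (M @\<^sub>r N) * X"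
  by (rule eq_matI)
    (use assms in \<open>auto simp: index_append_rows scalar_prod_def intro!: sum.cong\<close>)

text \<open>The shared row count \<open>r\<close> forces both concatenations to be cut at the same
  height, so reading entries above and below row \<open>r\<close> recovers the blocks. This serves
  to peel a stack of four apart and to identify two splittings of a solution
  \<open>X\<close>.\<close>

lemma append_rows_inject:
  assumes "M @\<^sub>r N = M' @\<^sub>r N'"
    and "M \<in> carrier_mat r k" "M' \<in> carrier_mat r k" "N \<in> carrier_mat s k" "N' \<in> carrier_mat s k"
  shows "M = M' \<and> N = N'"
proof
  show "M = M'"
  proof (rule eq_matI)
    fix i j assume "i < dim_row M'" "j < dim_col M'"
    then show "M $$ (i, j) = M' $$ (i, j)"
      using arg_cong[OF assms(1), of "\<lambda>P. P $$ (i, j)"] assms(2-)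
      by (simp add: index_append_rows)
  qed (use assms in auto)
  show "N = N'"
  proof (rule eq_matI)
    fix i j assume "i < dim_row N'" "j < dim_col N'"
    then show "N $$ (i, j) = N' $$ (i, j)"
      using arg_cong[OF assms(1), of "\<lambda>P. P $$ (r + i, j)"] assms(2-)
      by (simp add: index_append_rows)
  qed (use assms in auto)
qed

section \<open>Frobenius norms of concatenated matrices\<close>

lemma sum_lessThan_add:
  fixes f :: "nat \<Rightarrow> 'a::comm_monoid_add"
  shows "(\<Sum>i<a + b. f i) = (\<Sum>i<a. f i) + (\<Sum>i<b. f (a + i))"
  by (induction b) (simp_all add: add.assoc)

lemma frob_norm_squared:
  "(frob_norm M)\<^sup>2 = (\<Sum>i<dim_row M. \<Sum>j<dim_col M. (norm (M $$ (i, j)))\<^sup>2)"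
  unfolding frob_norm_def by (intro real_sqrt_pow2 sum_nonneg) simp

lemma frob_norm_nonneg: "frob_norm M \<ge> 0"
  unfolding frob_norm_def by (intro real_sqrt_ge_zero sum_nonneg) simp

lemma frob_norm_append_rows:
  assumes "dim_col M = dim_col N"
  shows "(frob_norm (M @\<^sub>r N))\<^sup>2 = (frob_norm M)\<^sup>2 + (frob_norm N)\<^sup>2"
  using assms by (simp add: frob_norm_squared sum_lessThan_add index_append_rows)

lemma frob_norm_append_cols:
  assumes "dim_row M = dim_row N"
  shows "(frob_norm (M @\<^sub>c N))\<^sup>2 = (frob_norm M)\<^sup>2 + (frob_norm N)\<^sup>2"
  using assms
  by (simp add: frob_norm_squared sum_lessThan_add append_cols_def sum.distrib)

section \<open>The stacking map: bijectivity, algebra and norm\<close>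

definition rb_stack :: "rbq mat \<Rightarrow> real mat" where
  "rb_stack M = stack4 (map_mat rb0 M) (map_mat rb1 M) (map_mat rb2 M) (map_mat rb3 M)"

lemma dim_rb_stack [simp]:
  "dim_row (rb_stack M) = 4 * dim_row M" "dim_col (rb_stack M) = dim_col M"
  by (simp_all add: rb_stack_def stack4_def)

lemma rb_stack_carrier_iff [simp]:
  "rb_stack M \<in> carrier_mat (4 * m) k \<longleftrightarrow> M \<in> carrier_mat m k"
  unfolding carrier_mat_def by simp

lemma rb_mat_carrier [simp]:
  assumes "M0 \<in> carrier_mat m k" "M1 \<in> carrier_mat m k"
    "M2 \<in> carrier_mat m k" "M3 \<in> carrier_mat m k"
  shows "rb_mat M0 M1 M2 M3 \<in> carrier_mat m k"
  using assms unfolding rb_mat_def by (intro carrier_matI) simp_all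

text \<open>Reading off components undoes the expansion in the basis 1, \<open>rb_i\<close>,
  \<open>rb_j\<close>, \<open>rb_k\<close>. This links matrices given by their components to the
  stacking map, which takes a single matrix.\<close>

lemma rb_stack_rb_mat:
  assumes "M0 \<in> carrier_mat m k" "M1 \<in> carrier_mat m k"
    "M2 \<in> carrier_mat m k" "M3 \<in> carrier_mat m k"
  shows "rb_stack (rb_mat M0 M1 M2 M3) = stack4 M0 M1 M2 M3"
proof -
  have "map_mat rb0 (rb_mat M0 M1 M2 M3) = M0" "map_mat rb1 (rb_mat M0 M1 M2 M3) = M1"
    "map_mat rb2 (rb_mat M0 M1 M2 M3) = M2" "map_mat rb3 (rb_mat M0 M1 M2 M3) = M3"
    using assms
    by (auto intro!: eq_matI simp: rb_mat_def rb_i_def rb_j_def rb_k_def)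
  then show ?thesis
    by (simp add: rb_stack_def)
qed

text \<open>The dimensions need not be assumed equal: the row count of a stack is four times that of
  its argument, so equality of stacks forces them to agree. The components are then compared block
  by block.\<close>

lemma rb_stack_inject:
  assumes "rb_stack M = rb_stack N"
  shows "M = N"
proof -
  have dims: "dim_row M = dim_row N" "dim_col M = dim_col N"
    using arg_cong[OF assms, of dim_row] arg_cong[OF assms, of dim_col] by simp_all
  have c: "map_mat f M \<in> carrier_mat (dim_row N) (dim_col N)"
    "map_mat f N \<in> carrier_mat (dim_row N) (dim_col N)" for f :: "rbq \<Rightarrow> real"
    using dims by auto
  \<comment> \<open>Facts 3 and 4 concern the lower two blocks, facts 5 and 6 the lower three; they
    provide the remainders when the top block is split off repeatedly.\<close>
  note cr = c carrier_append_rows[OF c(1) c(1)] carrier_append_rows[OF c(2) c(2)]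
    carrier_append_rows[OF c(1) carrier_append_rows[OF c(1) c(1)]]
    carrier_append_rows[OF c(2) carrier_append_rows[OF c(2) c(2)]]
  note eq = assms[unfolded rb_stack_def stack4_def]
  note eq0 = append_rows_inject[OF eq c cr(5,6)]
  note eq1 = append_rows_inject[OF conjunct2[OF eq0] c cr(3,4)]
  note eq2 = append_rows_inject[OF conjunct2[OF eq1] c c]
  have comp: "map_mat rb0 M = map_mat rb0 N" "map_mat rb1 M = map_mat rb1 N"
    "map_mat rb2 M = map_mat rb2 N" "map_mat rb3 M = map_mat rb3 N"
    using eq0 eq1 eq2 by auto
  show ?thesis
  proof (rule eq_matI)
    fix i j assume "i < dim_row N" "j < dim_col N"
    then show "M $$ (i, j) = N $$ (i, j)"
      using comp[THEN arg_cong, of "\<lambda>P. P $$ (i, j)"] dims by (simp add: rbq_eq_iff)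
  qed (use dims in auto)
qed

lemma rb_stack_surj:
  assumes "N \<in> carrier_mat (4 * m) k"
  obtains M where "M \<in> carrier_mat m k" "rb_stack M = N"
proof
  \<comment> \<open>The four components are read from consecutive blocks of \<open>m\<close> rows.
    The nested offsets undo the successive subtractions of \<open>m\<close> in
    \<open>index_append_rows\<close>.\<close>
  let ?M = "mat m k (\<lambda>(i, j). RBQ (N $$ (i, j)) (N $$ (m + i, j))
    (N $$ (m + (m + i), j)) (N $$ (m + (m + (m + i)), j)))"
  show "?M \<in> carrier_mat m k"
    by simp
  show "rb_stack ?M = N"
    by (rule eq_matI) (use assms in \<open>auto simp: rb_stack_def stack4_def index_append_rows\<close>)
qed

lemma rb_stack_add:
  assumes "M \<in> carrier_mat m k" "N \<in> carrier_mat m k"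
  shows "rb_stack (M + N) = rb_stack M + rb_stack N"
proof -
  have "map_mat rb0 (M + N) = map_mat rb0 M + map_mat rb0 N"
    "map_mat rb1 (M + N) = map_mat rb1 M + map_mat rb1 N"
    "map_mat rb2 (M + N) = map_mat rb2 M + map_mat rb2 N"
    "map_mat rb3 (M + N) = map_mat rb3 M + map_mat rb3 N"
    using assms by (auto intro!: eq_matI)
  then show ?thesis
    using assms by (simp add: rb_stack_def stack4_def add_append_rows)
qed

lemma rb_sum:
  "rb0 (sum f S) = (\<Sum>x\<in>S. rb0 (f x))" "rb1 (sum f S) = (\<Sum>x\<in>S. rb1 (f x))"
  "rb2 (sum f S) = (\<Sum>x\<in>S. rb2 (f x))" "rb3 (sum f S) = (\<Sum>x\<in>S. rb3 (f x))"
  by (induction S rule: infinite_finite_induct) simp_all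

text \<open>A real factor has zero \<open>rb1\<close>, \<open>rb2\<close> and \<open>rb3\<close>
  parts, so multiplication by it acts on each component separately. A factor with other parts would
  mix the components; this is where the unknown being real enters.\<close>

lemma rb_stack_mult_real:
  assumes "dim_col M = dim_row X"
  shows "rb_stack (M * rb_of_real_mat X) = rb_stack M * X"
proof -
  have "map_mat rb0 (M * rb_of_real_mat X) = map_mat rb0 M * X"
    "map_mat rb1 (M * rb_of_real_mat X) = map_mat rb1 M * X"
    "map_mat rb2 (M * rb_of_real_mat X) = map_mat rb2 M * X"
    "map_mat rb3 (M * rb_of_real_mat X) = map_mat rb3 M * X"
    using assms by (auto intro!: eq_matI sum.cong simp: scalar_prod_def rb_sum)
  then show ?thesis
    using assms by (simp add: rb_stack_def stack4_def mult_append_rows)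
qed

text \<open>The squared norm of an entry is the sum of the squares of its four components, so both
  sides sum the same real squares, grouped differently.\<close>

lemma frob_norm_rb_stack: "(frob_norm (rb_stack M))\<^sup>2 = (frob_norm M)\<^sup>2"
  by (simp add: rb_stack_def stack4_def frob_norm_append_rows)
    (simp add: frob_norm_squared norm_rbq_def sum.distrib)

text \<open>Squared norms split over the two blocks, so each block is compared on its own and
  stacking never has to be commuted with column concatenation.\<close>

lemma frob_norm_append_cols_rb_stack:
  assumes "dim_row E = dim_row G"
  shows "frob_norm (rb_stack E @\<^sub>c rb_stack G) = frob_norm (E @\<^sub>c G)"
proof (rule power2_eq_imp_eq)
  show "(frob_norm (rb_stack E @\<^sub>c rb_stack G))\<^sup>2 = (frob_norm (E @\<^sub>c G))\<^sup>2"
    using assms by (simp add: frob_norm_append_cols frob_norm_rb_stack)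
qed (rule frob_norm_nonneg)+

section \<open>Correspondence of feasible points and objective values\<close>

lemma mtls_feasible_rb_stack_iff:
  assumes "dim_row Aa = dim_row B" "dim_row Ab = dim_row B"
  shows "mtls_feasible (rb_stack Aa) (rb_stack Ab) (rb_stack B) (Xa, Xb, rb_stack E, rb_stack G)
    \<longleftrightarrow> rbmtls_feasible Aa Ab B (Xa, Xb, E, G)"
proof (cases "Xa \<in> carrier_mat (dim_col Aa) (dim_col B) \<and>
    Xb \<in> carrier_mat (dim_col Ab) (dim_col B) \<and>
    E \<in> carrier_mat (dim_row B) (dim_col Ab) \<and> G \<in> carrier_mat (dim_row B) (dim_col B)")
  case True
  then have c: "Aa * rb_of_real_mat Xa \<in> carrier_mat (dim_row B) (dim_col B)"
    "(Ab + E) * rb_of_real_mat Xb \<in> carrier_mat (dim_row B) (dim_col B)"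
    using assms by (auto intro!: carrier_matI)
  have "rb_stack (Aa * rb_of_real_mat Xa + (Ab + E) * rb_of_real_mat Xb)
      = rb_stack Aa * Xa + (rb_stack Ab + rb_stack E) * Xb"
    using True
    by (auto simp: rb_stack_add[OF c] rb_stack_mult_real
        rb_stack_add[OF carrier_matI[OF assms(2) refl]])
  moreover have "rb_stack (B + G) = rb_stack B + rb_stack G"
    using True by (intro rb_stack_add) auto
  \<comment> \<open>The real equation is the stacked form of the biquaternion one, so injectivity of
    stacking makes the two equivalent.\<close>
  ultimately have "rb_stack Aa * Xa + (rb_stack Ab + rb_stack E) * Xb = rb_stack B + rb_stack G
      \<longleftrightarrow> Aa * rb_of_real_mat Xa + (Ab + E) * rb_of_real_mat Xb = B + G"
    by (metis rb_stack_inject)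
  then show ?thesis
    using True by (simp add: mtls_feasible_def rbmtls_feasible_def)
next
  \<comment> \<open>Stacking keeps the column count and multiplies the row count by four, so a wrong
    dimension violates both feasibility predicates at once.\<close>
  case False
  then show ?thesis
    unfolding mtls_feasible_def rbmtls_feasible_def by auto
qed

text \<open>Surjectivity of stacking ensures that no feasible real perturbation is missed when only
  stacked pairs are considered.\<close>

lemma mtls_feasible_cases:
  assumes "mtls_feasible (rb_stack Aa) (rb_stack Ab) (rb_stack B) q"
  obtains Xa Xb E G where "q = (Xa, Xb, rb_stack E, rb_stack G)"
proof -
  obtain Xa Xb E' G' where q: "q = (Xa, Xb, E', G')"
    by (cases q) auto
  then have "E' \<in> carrier_mat (4 * dim_row B) (dim_col Ab)"
    "G' \<in> carrier_mat (4 * dim_row B) (dim_col B)"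
    using assms by (auto simp: mtls_feasible_def)
  then show thesis
    using q that by (metis rb_stack_surj)
qed

text \<open>Feasibility supplies the equal row counts of \<open>E\<close> and \<open>G\<close> under
  which the norms of the concatenations agree.\<close>

lemma tls_objective_rb_stack:
  assumes "rbmtls_feasible Aa Ab B (Xa, Xb, E, G)"
  shows "tls_objective (Xa, Xb, rb_stack E, rb_stack G) = tls_objective (Xa, Xb, E, G)"
  using assms by (auto simp: rbmtls_feasible_def tls_objective_def
      intro!: frob_norm_append_cols_rb_stack)

text \<open>The predicate in \<open>r\<close> is exactly the one under \<open>LEAST\<close> in both
  minimum values, so this equivalence can be rewritten there directly.\<close>

lemma mtls_attained_iff:
  assumes "dim_row Aa = dim_row B" "dim_row Ab = dim_row B"
  shows "(\<exists>q. mtls_feasible (rb_stack Aa) (rb_stack Ab) (rb_stack B) q \<and> r = tls_objective q)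
    \<longleftrightarrow> (\<exists>q. rbmtls_feasible Aa Ab B q \<and> r = tls_objective q)"
proof
  assume "\<exists>q. mtls_feasible (rb_stack Aa) (rb_stack Ab) (rb_stack B) q \<and> r = tls_objective q"
  then show "\<exists>q. rbmtls_feasible Aa Ab B q \<and> r = tls_objective q"
    by (metis mtls_feasible_cases mtls_feasible_rb_stack_iff[OF assms] tls_objective_rb_stack)
next
  assume "\<exists>q. rbmtls_feasible Aa Ab B q \<and> r = tls_objective q"
  then obtain Xa Xb E G where "rbmtls_feasible Aa Ab B (Xa, Xb, E, G)"
    "r = tls_objective (Xa, Xb, E, G)"
    by auto
  then show "\<exists>q. mtls_feasible (rb_stack Aa) (rb_stack Ab) (rb_stack B) q \<and> r = tls_objective q"
    using mtls_feasible_rb_stack_iff[OF assms] tls_objective_rb_stack by metis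
qed

section \<open>Transfer of minimum values, minimizers and solutions\<close>

lemma mtls_min_value_rb_stack:
  assumes "dim_row Aa = dim_row B" "dim_row Ab = dim_row B"
  shows "mtls_min_value (rb_stack Aa) (rb_stack Ab) (rb_stack B) = rbmtls_min_value Aa Ab B"
  \<comment> \<open>The two \<open>LEAST\<close> terms range over equal predicates, hence agree even
    without knowing that a minimum is attained.\<close>
  unfolding mtls_min_value_def rbmtls_min_value_def mtls_attained_iff[OF assms] ..

text \<open>Competing points enter only through the values they attain, the form in which
  \<open>mtls_attained_iff\<close> applies although the two problems have points of different
  types.\<close>

lemma is_arg_min_iff_attained:
  fixes f :: "'a \<Rightarrow> 'b::linorder"
  shows "is_arg_min f P x \<longleftrightarrow> P x \<and> (\<forall>r. (\<exists>y. P y \<and> r = f y) \<longrightarrow> f x \<le> r)"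
  by (auto simp: is_arg_min_linorder)

lemma mtls_minimizer_rb_stack_iff:
  assumes "dim_row Aa = dim_row B" "dim_row Ab = dim_row B"
  shows "mtls_minimizer (rb_stack Aa) (rb_stack Ab) (rb_stack B) (Xa, Xb, rb_stack E, rb_stack G)
    \<longleftrightarrow> rbmtls_minimizer Aa Ab B (Xa, Xb, E, G)"
  unfolding mtls_minimizer_def rbmtls_minimizer_def is_arg_min_iff_attained
    mtls_attained_iff[OF assms] mtls_feasible_rb_stack_iff[OF assms]
  \<comment> \<open>The objectives agree only at feasible points; \<open>conj_cong\<close> makes the
    feasibility conjunct available for that rewrite.\<close>
  by (simp add: tls_objective_rb_stack cong: conj_cong)

lemma mtls_solution_rb_stack_iff:
  assumes "dim_row Aa = dim_row B" "dim_row Ab = dim_row B"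
  shows "mtls_solution (rb_stack Aa) (rb_stack Ab) (rb_stack B) X \<longleftrightarrow> rbmtls_solution Aa Ab B X"
proof
  assume "mtls_solution (rb_stack Aa) (rb_stack Ab) (rb_stack B) X"
  then obtain Xa Xb E' G' where X: "X = Xa @\<^sub>r Xb" and
    min: "mtls_minimizer (rb_stack Aa) (rb_stack Ab) (rb_stack B) (Xa, Xb, E', G')"
    unfolding mtls_solution_def by blast
  from min have "mtls_feasible (rb_stack Aa) (rb_stack Ab) (rb_stack B) (Xa, Xb, E', G')"
    by (simp add: mtls_minimizer_def is_arg_min_def)
  then obtain E G where "E' = rb_stack E" "G' = rb_stack G"
    by (auto elim: mtls_feasible_cases)
  with X min show "rbmtls_solution Aa Ab B X"
    unfolding rbmtls_solution_def by (auto simp: mtls_minimizer_rb_stack_iff[OF assms])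
next
  assume "rbmtls_solution Aa Ab B X"
  then show "mtls_solution (rb_stack Aa) (rb_stack Ab) (rb_stack B) X"
    unfolding rbmtls_solution_def mtls_solution_def
    using mtls_minimizer_rb_stack_iff[OF assms] by blast
qed

lemma mtls_min_value_eqI:
  assumes "mtls_minimizer Ca Cb D q"
  shows "tls_objective q = mtls_min_value Ca Cb D"
  unfolding mtls_min_value_def
  using assms unfolding mtls_minimizer_def is_arg_min_iff_attained
  by (intro Least_equality[symmetric]) blast+

text \<open>The known minimizer \<open>q'\<close> guarantees that \<open>mtls_min_value\<close> is a
  true minimum; any feasible point with this value is then optimal too.\<close>

lemma mtls_minimizerI:
  assumes "mtls_minimizer Ca Cb D q'" "mtls_feasible Ca Cb D q"
    and "tls_objective q = mtls_min_value Ca Cb D"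
  shows "mtls_minimizer Ca Cb D q"
  using assms mtls_min_value_eqI[OF assms(1)]
  unfolding mtls_minimizer_def is_arg_min_iff_attained by simp

theorem theorem3p2:
  fixes m n d n1 n2 :: nat
    and Aa Ab B :: "rbq mat"
    and Aa0 Aa1 Aa2 Aa3 Ab0 Ab1 Ab2 Ab3 B0 B1 B2 B3 :: "real mat"
    and Ca Cb D X Xa Xb :: "real mat"
  assumes "m \<ge> 1" "n \<ge> 1" "d \<ge> 1" "n1 + n2 = n" "m > n" "m \<ge> n + d"
    and "Aa0 \<in> carrier_mat m n1" "Aa1 \<in> carrier_mat m n1"
        "Aa2 \<in> carrier_mat m n1" "Aa3 \<in> carrier_mat m n1"
    and "Ab0 \<in> carrier_mat m n2" "Ab1 \<in> carrier_mat m n2"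
        "Ab2 \<in> carrier_mat m n2" "Ab3 \<in> carrier_mat m n2"
    and "B0 \<in> carrier_mat m d" "B1 \<in> carrier_mat m d"
        "B2 \<in> carrier_mat m d" "B3 \<in> carrier_mat m d"
    and "Aa = rb_mat Aa0 Aa1 Aa2 Aa3" "Ab = rb_mat Ab0 Ab1 Ab2 Ab3" "B = rb_mat B0 B1 B2 B3"
    and "full_column_rank Aa"
    and "Ca = stack4 Aa0 Aa1 Aa2 Aa3" "Cb = stack4 Ab0 Ab1 Ab2 Ab3" "D = stack4 B0 B1 B2 B3"
    and "Xa \<in> carrier_mat n1 d" "Xb \<in> carrier_mat n2 d" "X = Xa @\<^sub>r Xb"
  shows "(rbmtls_solution Aa Ab B X \<longleftrightarrow> mtls_solution Ca Cb D X) \<and>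
    (mtls_solution Ca Cb D X \<longrightarrow>
      (\<exists>Et \<in> carrier_mat (4 * m) n2. \<exists>Gt \<in> carrier_mat (4 * m) d.
         Ca * Xa + (Cb + Et) * Xb = D + Gt \<and>
         frob_norm (Et @\<^sub>c Gt) = mtls_min_value Ca Cb D) \<and>
      (\<forall>Eb0 \<in> carrier_mat m n2. \<forall>Eb1 \<in> carrier_mat m n2.
       \<forall>Eb2 \<in> carrier_mat m n2. \<forall>Eb3 \<in> carrier_mat m n2.
       \<forall>G0 \<in> carrier_mat m d. \<forall>G1 \<in> carrier_mat m d.
       \<forall>G2 \<in> carrier_mat m d. \<forall>G3 \<in> carrier_mat m d.
         let Et = stack4 Eb0 Eb1 Eb2 Eb3; Gt = stack4 G0 G1 G2 G3;
             Eh = rb_mat Eb0 Eb1 Eb2 Eb3; Gh = rb_mat G0 G1 G2 G3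
         in Ca * Xa + (Cb + Et) * Xb = D + Gt \<and>
            frob_norm (Et @\<^sub>c Gt) = mtls_min_value Ca Cb D \<longrightarrow>
            Aa * rb_of_real_mat Xa + (Ab + Eh) * rb_of_real_mat Xb = B + Gh \<and>
            frob_norm (Eh @\<^sub>c Gh) = rbmtls_min_value Aa Ab B \<and>
            rbmtls_minimizer Aa Ab B (Xa, Xb, Eh, Gh) \<and>
            rbmtls_solution Aa Ab B X))"
proof -
  have dims: "dim_row Aa = dim_row B" "dim_row Ab = dim_row B"
    "dim_row D = 4 * m" "dim_col D = d" "dim_col Ca = n1" "dim_col Cb = n2"
    unfolding assms(19-21,23-25) using assms(7-18) by (simp_all add: rb_mat_def stack4_def)
  have stack: "Ca = rb_stack Aa" "Cb = rb_stack Ab" "D = rb_stack B"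
    unfolding assms(19-21,23-25)
      rb_stack_rb_mat[OF assms(7-10)] rb_stack_rb_mat[OF assms(11-14)] rb_stack_rb_mat[OF assms(15-18)]
    by (rule refl)+
  have solution_iff: "rbmtls_solution Aa Ab B X \<longleftrightarrow> mtls_solution Ca Cb D X"
    unfolding stack by (rule mtls_solution_rb_stack_iff[OF dims(1,2), symmetric])
  show ?thesis
  proof (intro conjI solution_iff impI)
    assume sol: "mtls_solution Ca Cb D X"
    then obtain Ya Yb E G where Y: "X = Ya @\<^sub>r Yb"
      and min: "mtls_minimizer Ca Cb D (Ya, Yb, E, G)"
      unfolding mtls_solution_def by blast
    from min have feas: "mtls_feasible Ca Cb D (Ya, Yb, E, G)"
      by (simp add: mtls_minimizer_def is_arg_min_def)
    then have "Ya \<in> carrier_mat n1 d" "Yb \<in> carrier_mat n2 d"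
      by (simp_all add: mtls_feasible_def dims)
    moreover have "Xa \<in> carrier_mat n1 d" "Xb \<in> carrier_mat n2 d" "Xa @\<^sub>r Xb = Ya @\<^sub>r Yb"
      using assms(26-28) Y by simp_all
    \<comment> \<open>\<open>mtls_solution\<close> only provides some splitting of \<open>X\<close>.
      Feasibility gives its blocks the dimensions of \<open>Xa\<close> and \<open>Xb\<close>, so it
      is the given splitting and \<open>E\<close>, \<open>G\<close> serve as the required
      perturbations.\<close>
    ultimately have "Ya = Xa" "Yb = Xb"
      using append_rows_inject[of Xa Xb Ya Yb n1 d n2] by simp_all
    with feas have "Ca * Xa + (Cb + E) * Xb = D + G" "E \<in> carrier_mat (4 * m) n2"
      "G \<in> carrier_mat (4 * m) d"
      by (simp_all add: mtls_feasible_def dims)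
    moreover have "frob_norm (E @\<^sub>c G) = mtls_min_value Ca Cb D"
      using mtls_min_value_eqI[OF min] by (simp add: tls_objective_def)
    ultimately show "\<exists>Et \<in> carrier_mat (4 * m) n2. \<exists>Gt \<in> carrier_mat (4 * m) d.
        Ca * Xa + (Cb + Et) * Xb = D + Gt \<and> frob_norm (Et @\<^sub>c Gt) = mtls_min_value Ca Cb D"
      by blast
    have transfer: "Aa * rb_of_real_mat Xa + (Ab + Eh) * rb_of_real_mat Xb = B + Gh \<and>
        frob_norm (Eh @\<^sub>c Gh) = rbmtls_min_value Aa Ab B \<and>
        rbmtls_minimizer Aa Ab B (Xa, Xb, Eh, Gh) \<and> rbmtls_solution Aa Ab B X"
      if Eh: "Eh \<in> carrier_mat m n2" and Gh: "Gh \<in> carrier_mat m d"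
        and eq: "Ca * Xa + (Cb + rb_stack Eh) * Xb = D + rb_stack Gh"
        and val: "frob_norm (rb_stack Eh @\<^sub>c rb_stack Gh) = mtls_min_value Ca Cb D" for Eh Gh
    proof -
      have feas': "mtls_feasible Ca Cb D (Xa, Xb, rb_stack Eh, rb_stack Gh)"
        using that assms(26,27) by (simp add: mtls_feasible_def dims)
      \<comment> \<open>Optimality is first obtained in the real problem, where \<open>min\<close>
        shows that the minimum is attained, and only then carried over.\<close>
      have "mtls_minimizer Ca Cb D (Xa, Xb, rb_stack Eh, rb_stack Gh)"
        using val by (intro mtls_minimizerI[OF min feas']) (simp add: tls_objective_def)
      then have min': "rbmtls_minimizer Aa Ab B (Xa, Xb, Eh, Gh)"
        unfolding stack mtls_minimizer_rb_stack_iff[OF dims(1,2)] .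
      then have "Aa * rb_of_real_mat Xa + (Ab + Eh) * rb_of_real_mat Xb = B + Gh"
        by (simp add: rbmtls_minimizer_def is_arg_min_def rbmtls_feasible_def)
      moreover have "frob_norm (Eh @\<^sub>c Gh) = rbmtls_min_value Aa Ab B"
        using val Eh Gh unfolding stack mtls_min_value_rb_stack[OF dims(1,2)]
        by (simp add: frob_norm_append_cols_rb_stack)
      ultimately show ?thesis
        using min' sol solution_iff by blast
    qed
    show "\<forall>Eb0 \<in> carrier_mat m n2. \<forall>Eb1 \<in> carrier_mat m n2.
       \<forall>Eb2 \<in> carrier_mat m n2. \<forall>Eb3 \<in> carrier_mat m n2.
       \<forall>G0 \<in> carrier_mat m d. \<forall>G1 \<in> carrier_mat m d.
       \<forall>G2 \<in> carrier_mat m d. \<forall>G3 \<in> carrier_mat m d.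
         let Et = stack4 Eb0 Eb1 Eb2 Eb3; Gt = stack4 G0 G1 G2 G3;
             Eh = rb_mat Eb0 Eb1 Eb2 Eb3; Gh = rb_mat G0 G1 G2 G3
         in Ca * Xa + (Cb + Et) * Xb = D + Gt \<and>
            frob_norm (Et @\<^sub>c Gt) = mtls_min_value Ca Cb D \<longrightarrow>
            Aa * rb_of_real_mat Xa + (Ab + Eh) * rb_of_real_mat Xb = B + Gh \<and>
            frob_norm (Eh @\<^sub>c Gh) = rbmtls_min_value Aa Ab B \<and>
            rbmtls_minimizer Aa Ab B (Xa, Xb, Eh, Gh) \<and>
            rbmtls_solution Aa Ab B X"
      unfolding Let_def
    proof (intro ballI impI)
      fix Eb0 Eb1 Eb2 Eb3 G0 G1 G2 G3
      assume Eb: "Eb0 \<in> carrier_mat m n2" "Eb1 \<in> carrier_mat m n2"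
          "Eb2 \<in> carrier_mat m n2" "Eb3 \<in> carrier_mat m n2"
        and G: "G0 \<in> carrier_mat m d" "G1 \<in> carrier_mat m d"
          "G2 \<in> carrier_mat m d" "G3 \<in> carrier_mat m d"
        and opt: "Ca * Xa + (Cb + stack4 Eb0 Eb1 Eb2 Eb3) * Xb = D + stack4 G0 G1 G2 G3 \<and>
          frob_norm (stack4 Eb0 Eb1 Eb2 Eb3 @\<^sub>c stack4 G0 G1 G2 G3) = mtls_min_value Ca Cb D"
      show "Aa * rb_of_real_mat Xa + (Ab + rb_mat Eb0 Eb1 Eb2 Eb3) * rb_of_real_mat Xb
          = B + rb_mat G0 G1 G2 G3 \<and>
        frob_norm (rb_mat Eb0 Eb1 Eb2 Eb3 @\<^sub>c rb_mat G0 G1 G2 G3) = rbmtls_min_value Aa Ab B \<and>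
        rbmtls_minimizer Aa Ab B (Xa, Xb, rb_mat Eb0 Eb1 Eb2 Eb3, rb_mat G0 G1 G2 G3) \<and>
        rbmtls_solution Aa Ab B X"
        \<comment> \<open>Stacking the matrices assembled by \<open>rb_mat\<close> returns the given
          \<open>stack4\<close> matrices, which turns \<open>opt\<close> into the hypotheses of
          \<open>transfer\<close>.\<close>
        using opt by (intro transfer rb_mat_carrier Eb G)
          (simp_all only: rb_stack_rb_mat[OF Eb] rb_stack_rb_mat[OF G])
    qed
  qed
qed

end
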